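(* Let $X\subseteq\mathbb{R}^n$ be nonempty, closed, convex and bounded, let $f_1,\dots,f_m:\mathbb{R}^n\to\mathbb{R}$ be convex, let $f=\sum_{i=1}^m f_i$ and $f^*=\min_{x\in X}f(x)$. Let $C_i$ be a constant such that $\|v\|\le C_i$ for every subgradient $v$ of $f_i$ at every point $x\in X$. Let $\{x_k\}$ be generated by the cyclic incremental stochastic subgradient method with constant step-size $\alpha>0$: $$z_{0,k+1}=x_k,\qquad z_{i,k+1}=\mathcal{P}_X\big[z_{i-1,k+1}-\alpha\big(\nabla f_i(z_{i-1,k+1})+\epsilon_{i,k+1}\big)\big]\ (i=1,\dots,m),\qquad x_{k+1}=z_{m,k+1},\qquad k\ge 0,$$ with a random initial vector $x_0\in X$, where the errors satisfy, for deterministic nonnegative sequences $\{\mu_k\}$, $\{\nu_k\}$ and all $i\in\{1,\dots,m\}$, $k\ge1$, $$\big\|\mathsf{E}[\epsilon_{i,k}\mid F_k^{i-1}]\big\|\le\mu_k,\qquad \mathsf{E}\big[\|\epsilon_{i,k}\|^2\mid F_k^{i-1}\big]\le\nu_k^2 ,$$ and $\mu=\sup_{k\ge1}\mu_k<\infty$, $\nu=\sup_{k\ge1}\nu_k<\infty$. Then $$\liminf_{k\to\infty}\mathsf{E}[f(x_k)]\le f^*+m\mu\max_{x,y\in X}\|x-y\|+\frac{\alpha}{2}\Big(\sum_{i=1}^m C_i+m\nu\Big)^2,$$ and, with probability 1, $$\inf_{k\ge0}f(x_k)\le f^*+m\mu\max_{x,y\in X}\|x-y\|+\frac{\alpha}{2}\Big(\sum_{i=1}^m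 C_i+m\nu\Big)^2 .$$
   Context: $\|\cdot\|$ is the Euclidean norm and $\mathcal{P}_X$ is the Euclidean projection onto $X$. A vector $v$ is a subgradient of a convex function $g:\mathbb{R}^n\to\mathbb{R}$ at $x$ if $v^T(y-x)\le g(y)-g(x)$ for all $y\in\mathbb{R}^n$; $\nabla f_i(x)$ denotes a (chosen) subgradient of $f_i$ at $x$. Such constants $C_i$ exist because $X$ is compact and $f_i$ is convex on $\mathbb{R}^n$. All random quantities live on one probability space; $F_k^i$ is the $\sigma$-algebra generated by $x_0$ and the errors $\epsilon_{1,1},\dots,\epsilon_{i,k}$ in order of occurrence (all errors of cycles $1,\dots,k-1$ and the errors $\epsilon_{1,k},\dots,\epsilon_{i,k}$ of cycle $k$), with $F_k^0=F_{k-1}^m$ and $F_0^m=\sigma(x_0)$. The subgradients are selected so that $z_{i,k}$ is $F_k^i$-measurable. *)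

theory Defs
  imports "HOL-Probability.Probability"
begin

definition is_subgradient :: "('a::real_inner \<Rightarrow> real) \<Rightarrow> 'a \<Rightarrow> 'a \<Rightarrow> bool" where
  "is_subgradient g v x \<longleftrightarrow> (\<forall>y. v \<bullet> (y - x) \<le> g y - g x)"

(* Error e j l occurs in cycle l >= 1 at inner step j in {1..m}; up to inner step i of cycle k,
   the errors that have occurred are those with l < k, and those with l = k and j <= i.
   In particular history k 0 = history (k - 1) m for k >= 1, and history 0 m is generated
   by the initial vector alone. *)
definition history ::
  "'w measure \<Rightarrow> nat \<Rightarrow> ('w \<Rightarrow> 'a::topological_space) \<Rightarrow> (nat \<Rightarrow> nat \<Rightarrow> 'w \<Rightarrow> 'a)
    \<Rightarrow> nat \<Rightarrow> nat \<Rightarrow> 'w measure" where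
  "history M m x0 e k i = sigma (space M)
     ({x0 -` A \<inter> space M | A. A \<in> sets borel} \<union>
      {e j l -` A \<inter> space M | j l A.
         A \<in> sets borel \<and> 1 \<le> l \<and> 1 \<le> j \<and> (l < k \<and> j \<le> m \<or> l = k \<and> j \<le> i)})"

(* The library's conditional expectation is real-valued; for random vectors it is taken
   componentwise. *)
definition vec_cond_exp ::
  "'w measure \<Rightarrow> 'w measure \<Rightarrow> ('w \<Rightarrow> real ^ 'n) \<Rightarrow> 'w \<Rightarrow> real ^ 'n" where
  "vec_cond_exp M F e w = (\<chi> j. real_cond_exp M F (\<lambda>u. e u $ j) w)"

end

theory Submission imports Defs begin

text \<open>
One cycle of the method decreases the squared distance to any reference point \<open>y\<close> of \<open>X\<close> by about
\<open>2 * \<alpha> * (F x - F y)\<close>, where \<open>x\<close> is the iterate at the start of the cycle, up to three losses: the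
bias of the errors, the length of the steps, and the fact that the subgradient of \<open>f i\<close> is taken at an
inner iterate that has drifted from \<open>x\<close>. The drift is paired with the Lipschitz constant \<open>C i\<close>, so
every term except the bias contains at most one error, at most squared; in the bias term the error of a
step is paired with the inner iterate before it, which is known to the past. Hence no joint moments of
the norms of different errors arise (\<open>incremental_cycle_descent\<close>). On average the last two losses complete one square and amount to at most
\<open>\<alpha>\<^sup>2 * ((\<Sum>i=1..m. C i) + real m * \<nu>)\<^sup>2\<close>.

Integrating over an event \<open>S\<close> that is known when the cycle starts replaces the errors by their conditional
bounds, and all losses become proportional to the probability of \<open>S\<close> (\<open>expected_cycle_descent\<close>). So if
\<open>S k\<close> is a decreasing sequence of such events on which the objective stays on average above
\<open>F y + tolerance + \<delta>\<close>, the integrals of the squared distance over \<open>S k\<close> decrease by a fixed multiple of the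
probability of the intersection in every cycle. They are nonnegative, so this probability is zero
(\<open>persistent_event_null\<close>).

Both claims are instances, with \<open>y\<close> an approximate minimizer: for the limit inferior of the expectations
every \<open>S k\<close> is the whole space, and for the almost sure bound \<open>S k\<close> is the event that the objective exceeds
the level at the first \<open>k + 1\<close> iterates.
\<close>



section \<open>Convexity and projected steps\<close>

text \<open>A supporting hyperplane of the epigraph has this slope. Since only the subgradients at inner iterates
are chosen by the method, existence at other points is what makes the constants \<open>C i\<close> usable as
Lipschitz constants, and it makes them nonnegative.\<close>

lemma convex_subgradient_exists:
  fixes f :: "'a::euclidean_space \<Rightarrow> real"
  assumes cvx: "convex_on UNIV f"
  shows "\<exists>v. is_subgradient f v x"
proof -
  \<comment> \<open>The strict epigraph misses the graph point over the given argument, so a hyperplane separates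
    them; up to the sign and size of its last coefficient, its slope is the subgradient.\<close>
  define S where "S = {p :: 'a \<times> real. f (fst p) < snd p}"
  have "convex S"
    unfolding convex_alt
  proof (intro ballI allI impI)
    fix p q :: "'a \<times> real" and u :: real
    assume p: "p \<in> S" and q: "q \<in> S" and u: "0 \<le> u \<and> u \<le> 1"
    have "f ((1 - u) *\<^sub>R fst p + u *\<^sub>R fst q) \<le> (1 - u) * f (fst p) + u * f (fst q)"
      using convex_onD[OF cvx] u by auto
    also have "\<dots> < (1 - u) * snd p + u * snd q"
    proof (cases "u = 0")
      case True
      then show ?thesis using p by (simp add: S_def)
    next
      case False
      have "(1 - u) * f (fst p) \<le> (1 - u) * snd p"
        using p u by (intro mult_left_mono) (auto simp: S_def)
      moreover have "u * f (fst q) < u * snd q"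
        using q u False by (intro mult_strict_left_mono) (auto simp: S_def)
      ultimately show ?thesis by linarith
    qed
    finally show "(1 - u) *\<^sub>R p + u *\<^sub>R q \<in> S" by (simp add: S_def)
  qed
  moreover have "S \<noteq> {}"
  proof -
    have "(x, f x + 1) \<in> S" by (simp add: S_def)
    then show ?thesis by blast
  qed
  moreover have "S \<inter> {(x, f x)} = {}" by (auto simp: S_def)
  ultimately obtain a b where a: "a \<noteq> 0" "\<And>p. p \<in> S \<Longrightarrow> a \<bullet> p \<le> b" "b \<le> a \<bullet> (x, f x)"
    using separating_hyperplane_sets[of S "{(x, f x)}"] by (metis empty_not_insert convex_singleton insertI1)
  obtain p q where pq: "a = (p, q)" by (cases a)
  have sep: "p \<bullet> y + q * t \<le> p \<bullet> x + q * f x" if "f y < t" for y t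
    using a(2)[of "(y, t)"] a(3) that by (simp add: pq S_def)
  have "q \<le> 0" using sep[of x "f x + 1"] by (simp add: algebra_simps)
  \<comment> \<open>A vertical hyperplane would bound a nonzero linear functional on the whole space.\<close>
  have "q \<noteq> 0"
  proof
    assume "q = 0"
    then have "p \<bullet> (x + p) \<le> p \<bullet> x" using sep[of "x + p" "f (x + p) + 1"] by simp
    then have "p \<bullet> p \<le> 0" by (simp add: inner_add_right)
    then have "p = 0" by (simp add: power2_norm_eq_inner[symmetric])
    with \<open>q = 0\<close> a(1) pq show False by (simp add: zero_prod_def)
  qed
  with \<open>q \<le> 0\<close> have q: "q < 0" by simp
  have "((1 / - q) *\<^sub>R p) \<bullet> (y - x) \<le> f y - f x" for y
  proof -
    have "p \<bullet> (y - x) \<le> - q * (f y - f x)"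
    proof (rule field_le_epsilon)
      fix d :: real assume d: "d > 0"
      have "f y < f y + d / - q" using d q by (simp add: divide_pos_neg)
      from sep[OF this] show "p \<bullet> (y - x) \<le> - q * (f y - f x) + d"
        using q by (simp add: algebra_simps)
    qed
    then show ?thesis using q by (simp add: field_simps)
  qed
  then show ?thesis unfolding is_subgradient_def by blast
qed

text \<open>With \<open>a i\<close> bounding the mean length of an inner step per unit of step-size, the diagonal terms come from
the squared steps and the cross terms from the drift of the inner iterates away from the start of the
cycle.\<close>

lemma sum_square_triangular:
  fixes a :: "nat \<Rightarrow> real"
  shows "(\<Sum>i=1..m. a i)\<^sup>2 = (\<Sum>i=1..m. 2 * a i * (\<Sum>j=1..<i. a j) + (a i)\<^sup>2)"
proof (induction m)
  case (Suc m)
  have "{1..<Suc m} = {1..m}" by auto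
  then show ?case using Suc by (simp add: power2_sum algebra_simps)
qed simp

lemma projected_step_displacement:
  fixes X :: "'a::euclidean_space set"
  assumes X: "convex X" "closed X" "X \<noteq> {}" and z: "z \<in> X"
    and \<alpha>: "\<alpha> \<ge> 0" and g: "norm g \<le> C"
  shows "norm (closest_point X (z - \<alpha> *\<^sub>R (g + e)) - z) \<le> \<alpha> * (C + norm e)"
proof -
  have "norm (closest_point X (z - \<alpha> *\<^sub>R (g + e)) - z) \<le> norm ((z - \<alpha> *\<^sub>R (g + e)) - z)"
    using closest_point_lipschitz[OF X, of "z - \<alpha> *\<^sub>R (g + e)" z] closest_point_self[OF z]
    by (simp add: dist_norm)
  also have "\<dots> = \<alpha> * norm (g + e)" using \<alpha> by simp
  also have "\<dots> \<le> \<alpha> * (C + norm e)"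
    using \<alpha> g norm_triangle_ineq[of g e] by (intro mult_left_mono) auto
  finally show ?thesis .
qed

text \<open>The projection is nonexpansive and fixes \<open>y\<close>, so only the distance before projecting has to be
expanded. The error is kept in the linear term and estimated by its norm in the quadratic one, which
leaves only \<open>e\<close>, and not the subgradient, to be integrated later on.\<close>

lemma projected_step_descent:
  fixes X :: "'a::euclidean_space set"
  assumes X: "convex X" "closed X" "X \<noteq> {}" and y: "y \<in> X"
    and \<alpha>: "\<alpha> \<ge> 0" and sub: "is_subgradient f g z" and g: "norm g \<le> C"
  shows "(norm (closest_point X (z - \<alpha> *\<^sub>R (g + e)) - y))\<^sup>2
    \<le> (norm (z - y))\<^sup>2 - 2 * \<alpha> * (f z - f y) - 2 * \<alpha> * (e \<bullet> (z - y)) + \<alpha>\<^sup>2 * (C + norm e)\<^sup>2"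
proof -
  have "norm (closest_point X (z - \<alpha> *\<^sub>R (g + e)) - y) \<le> norm ((z - \<alpha> *\<^sub>R (g + e)) - y)"
    using closest_point_lipschitz[OF X, of "z - \<alpha> *\<^sub>R (g + e)" y] closest_point_self[OF y]
    by (simp add: dist_norm)
  then have "(norm (closest_point X (z - \<alpha> *\<^sub>R (g + e)) - y))\<^sup>2 \<le> (norm ((z - y) - \<alpha> *\<^sub>R (g + e)))\<^sup>2"
    by (intro power_mono) (simp_all add: algebra_simps)
  also have "\<dots> = (norm (z - y))\<^sup>2 - 2 * \<alpha> * ((g + e) \<bullet> (z - y)) + \<alpha>\<^sup>2 * (norm (g + e))\<^sup>2"
  proof -
    have "(norm (u - \<alpha> *\<^sub>R v))\<^sup>2 = (norm u)\<^sup>2 - 2 * \<alpha> * (v \<bullet> u) + \<alpha>\<^sup>2 * (norm v)\<^sup>2" for u v :: 'a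
      unfolding power2_norm_eq_inner
      by (simp add: inner_diff_left inner_diff_right inner_commute power2_eq_square algebra_simps)
    then show ?thesis .
  qed
  also have "\<alpha>\<^sup>2 * (norm (g + e))\<^sup>2 \<le> \<alpha>\<^sup>2 * (C + norm e)\<^sup>2"
    using g norm_triangle_ineq[of g e] by (intro mult_left_mono power_mono) auto
  also have "(norm (z - y))\<^sup>2 - 2 * \<alpha> * ((g + e) \<bullet> (z - y)) \<le>
      (norm (z - y))\<^sup>2 - 2 * \<alpha> * (f z - f y) - 2 * \<alpha> * (e \<bullet> (z - y))"
  proof -
    have "f z - f y \<le> g \<bullet> (z - y)"
      using sub[unfolded is_subgradient_def, rule_format, of y] by (simp add: inner_diff_right)
    from mult_left_mono[OF this \<alpha>] show ?thesis by (simp add: inner_add_left algebra_simps)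
  qed
  finally show ?thesis by simp
qed

text \<open>Adding up the descents of the inner steps gives values of \<open>f i\<close> at the inner iterates. Replacing these
by values at the start of the cycle costs at most \<open>C i\<close> times the drift, and the drift is at most
the sum of the lengths of the earlier steps. This is pathwise; no randomness is involved yet.\<close>

lemma incremental_cycle_descent:
  fixes X :: "'a::euclidean_space set" and f :: "nat \<Rightarrow> 'a \<Rightarrow> real"
  assumes X: "convex X" "closed X" "X \<noteq> {}" and y: "y \<in> X" and \<alpha>: "\<alpha> \<ge> 0"
    and cvx: "\<And>i. i \<in> {1..m} \<Longrightarrow> convex_on UNIV (f i)"
    and C: "\<And>i y v. i \<in> {1..m} \<Longrightarrow> y \<in> X \<Longrightarrow> is_subgradient (f i) v y \<Longrightarrow> norm v \<le> C i"
    and z0: "z 0 \<in> X"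
    and sub: "\<And>i. i \<in> {1..m} \<Longrightarrow> is_subgradient (f i) (g i) (z (i - 1))"
    and step: "\<And>i. i \<in> {1..m} \<Longrightarrow> z i = closest_point X (z (i - 1) - \<alpha> *\<^sub>R (g i + e i))"
  shows "(norm (z m - y))\<^sup>2 \<le> (norm (z 0 - y))\<^sup>2
      - 2 * \<alpha> * ((\<Sum>i=1..m. f i (z 0)) - (\<Sum>i=1..m. f i y))
      - 2 * \<alpha> * (\<Sum>i=1..m. e i \<bullet> (z (i - 1) - y))
      + \<alpha>\<^sup>2 * (\<Sum>i=1..m. 2 * C i * (\<Sum>j=1..<i. C j + norm (e j)) + (C i + norm (e i))\<^sup>2)"
proof -
  have inX: "z i \<in> X" if "i \<le> m" for i
    using that z0 step[of i] closest_point_in_set[OF X(2,3)] by (cases i) auto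
  have C0: "0 \<le> C i" if "i \<in> {1..m}" for i
    using convex_subgradient_exists[OF cvx[OF that], of y] C[OF that y] norm_ge_zero order_trans
    by blast
  have drift: "norm (z n - z 0) \<le> \<alpha> * (\<Sum>j=1..<Suc n. C j + norm (e j))" if "n \<le> m" for n
    using that
  proof (induction n)
    case (Suc n)
    have i: "Suc n \<in> {1..m}" using Suc.prems by simp
    have "norm (z (Suc n) - z n) \<le> \<alpha> * (C (Suc n) + norm (e (Suc n)))"
      using projected_step_displacement[OF X inX \<alpha> C[OF i inX sub[OF i]]] step[OF i] Suc.prems
      by simp
    then show ?case
      using norm_triangle_ineq[of "z (Suc n) - z n" "z n - z 0"] Suc
      by (simp add: algebra_simps)
  qed simp
  let ?T = "\<lambda>i. - 2 * \<alpha> * (f i (z 0) - f i y) - 2 * \<alpha> * (e i \<bullet> (z (i - 1) - y))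
      + \<alpha>\<^sup>2 * (2 * C i * (\<Sum>j=1..<i. C j + norm (e j)) + (C i + norm (e i))\<^sup>2)"
  have one: "(norm (z i - y))\<^sup>2 \<le> (norm (z (i - 1) - y))\<^sup>2 + ?T i" if i: "i \<in> {1..m}" for i
  proof -
    have zi: "z (i - 1) \<in> X" using inX[of "i - 1"] i by auto
    obtain v where v: "is_subgradient (f i) v (z 0)"
      using convex_subgradient_exists[OF cvx[OF i]] by blast
    \<comment> \<open>A subgradient at the start of the cycle is used: the one at the inner iterate
      bounds the difference from the other side.\<close>
    have "f i (z 0) - f i (z (i - 1)) \<le> v \<bullet> (z 0 - z (i - 1))"
      using v[unfolded is_subgradient_def, rule_format, of "z (i - 1)"]
      by (simp add: inner_diff_right)
    also have "\<dots> \<le> norm v * norm (z (i - 1) - z 0)"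
      using norm_cauchy_schwarz[of v "z 0 - z (i - 1)"] by (simp add: norm_minus_commute)
    also have "\<dots> \<le> C i * (\<alpha> * (\<Sum>j=1..<i. C j + norm (e j)))"
    proof (intro mult_mono)
      show "norm (z (i - 1) - z 0) \<le> \<alpha> * (\<Sum>j=1..<i. C j + norm (e j))"
      proof -
        have "Suc (i - 1) = i" using i by simp
        with drift[of "i - 1"] i show ?thesis by (metis atLeastAtMost_iff diff_le_self le_trans)
      qed
    qed (use C[OF i z0 v] C0[OF i] in auto)
    finally have "\<alpha> * (f i (z 0) - f i (z (i - 1))) \<le> \<alpha> * (C i * (\<alpha> * (\<Sum>j=1..<i. C j + norm (e j))))"
      using \<alpha> by (intro mult_left_mono)
    moreover have "(norm (z i - y))\<^sup>2 \<le> (norm (z (i - 1) - y))\<^sup>2 - 2 * \<alpha> * (f i (z (i - 1)) - f i y)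
        - 2 * \<alpha> * (e i \<bullet> (z (i - 1) - y)) + \<alpha>\<^sup>2 * (C i + norm (e i))\<^sup>2"
      using projected_step_descent[OF X y \<alpha> sub[OF i] C[OF i zi sub[OF i]]] step[OF i] by simp
    ultimately show ?thesis by (simp add: algebra_simps power2_eq_square)
  qed
  have "(norm (z n - y))\<^sup>2 \<le> (norm (z 0 - y))\<^sup>2 + (\<Sum>i=1..n. ?T i)" if "n \<le> m" for n
    using that
  proof (induction n)
    case (Suc n)
    then show ?case using one[of "Suc n"] by simp
  qed simp
  note total = this[of m, OF order_refl]
  have sum_T: "(\<Sum>i=1..m. ?T i) = - 2 * \<alpha> * ((\<Sum>i=1..m. f i (z 0)) - (\<Sum>i=1..m. f i y))
      - 2 * \<alpha> * (\<Sum>i=1..m. e i \<bullet> (z (i - 1) - y))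
      + \<alpha>\<^sup>2 * (\<Sum>i=1..m. 2 * C i * (\<Sum>j=1..<i. C j + norm (e j)) + (C i + norm (e i))\<^sup>2)"
    by (simp only: sum.distrib sum_subtractf sum_distrib_left[symmetric])
  show ?thesis using total unfolding sum_T by linarith
qed

section \<open>Conditional moments integrated over past events\<close>

text \<open>Integrating the conditional expectation over an event of the sub-\<open>\<sigma>\<close>-algebra turns the almost sure bound
into a bound proportional to the probability of the event. In particular the errors are square
integrable.\<close>

lemma (in finite_measure_subalgebra) second_moment_on_event:
  fixes e :: "'a \<Rightarrow> 'b::{real_normed_vector, second_countable_topology}"
  assumes e[measurable]: "e \<in> borel_measurable M"
    and bound: "AE w in M. nn_cond_exp M F (\<lambda>u. ennreal ((norm (e u))\<^sup>2)) w \<le> ennreal (\<nu>\<^sup>2)"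
  shows "integrable M (\<lambda>w. (norm (e w))\<^sup>2)"
    and "S \<in> sets F \<Longrightarrow> (\<integral>w. indicator S w * (norm (e w))\<^sup>2 \<partial>M) \<le> \<nu>\<^sup>2 * measure M S"
proof -
  have SM: "S \<in> sets M" if "S \<in> sets F" for S using that subalg by (auto simp: subalgebra_def)
  have main: "(\<integral>\<^sup>+w. indicator S w * ennreal ((norm (e w))\<^sup>2) \<partial>M) \<le> ennreal (\<nu>\<^sup>2 * measure M S)"
    if S: "S \<in> sets F" for S
  proof -
    have [measurable]: "S \<in> sets M" using SM[OF S] .
    have "(\<integral>\<^sup>+w. indicator S w * ennreal ((norm (e w))\<^sup>2) \<partial>M)
        = (\<integral>\<^sup>+w. indicator S w * nn_cond_exp M F (\<lambda>u. ennreal ((norm (e u))\<^sup>2)) w \<partial>M)"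
      using S by (intro nn_cond_exp_intg[symmetric]) auto
    also have "\<dots> \<le> (\<integral>\<^sup>+w. ennreal (\<nu>\<^sup>2) * indicator S w \<partial>M)"
      using bound by (intro nn_integral_mono_AE) (auto simp: indicator_def elim!: eventually_mono)
    also have "\<dots> = ennreal (\<nu>\<^sup>2 * measure M S)"
      by (simp add: nn_integral_cmult emeasure_eq_measure ennreal_mult)
    finally show ?thesis .
  qed
  have top: "space M \<in> sets F" using subalg by (metis sets.top subalgebra_def)
  have "(\<integral>\<^sup>+w. ennreal ((norm (e w))\<^sup>2) \<partial>M) = (\<integral>\<^sup>+w. indicator (space M) w * ennreal ((norm (e w))\<^sup>2) \<partial>M)"
    by (intro nn_integral_cong) simp
  also have "\<dots> < \<infinity>" using main[OF top] by (simp add: le_less_trans)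
  finally show int: "integrable M (\<lambda>w. (norm (e w))\<^sup>2)"
    by (intro integrableI_bounded) auto
  show "(\<integral>w. indicator S w * (norm (e w))\<^sup>2 \<partial>M) \<le> \<nu>\<^sup>2 * measure M S" if S: "S \<in> sets F"
  proof -
    have [measurable]: "S \<in> sets M" using SM[OF S] .
    have "ennreal (\<integral>w. indicator S w * (norm (e w))\<^sup>2 \<partial>M)
      = (\<integral>\<^sup>+w. ennreal (indicator S w * (norm (e w))\<^sup>2) \<partial>M)"
      using int by (intro nn_integral_eq_integral[symmetric] integrable_real_mult_indicator
          integrable_mult_indicator[where 'b=real, simplified]) auto
    also have "\<dots> = (\<integral>\<^sup>+w. indicator S w * ennreal ((norm (e w))\<^sup>2) \<partial>M)"
      by (intro nn_integral_cong) (auto simp: indicator_def)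
    also have "\<dots> \<le> ennreal (\<nu>\<^sup>2 * measure M S)" by (rule main[OF S])
    finally show ?thesis by (subst (asm) ennreal_le_iff) auto
  qed
qed

lemma (in finite_measure_subalgebra) first_moment_on_event:
  fixes e :: "'a \<Rightarrow> 'b::{real_normed_vector, second_countable_topology}"
  assumes e[measurable]: "e \<in> borel_measurable M" and \<nu>: "0 \<le> \<nu>"
    and bound: "AE w in M. nn_cond_exp M F (\<lambda>u. ennreal ((norm (e u))\<^sup>2)) w \<le> ennreal (\<nu>\<^sup>2)"
  shows "integrable M (\<lambda>w. norm (e w))"
    and "S \<in> sets F \<Longrightarrow> (\<integral>w. indicator S w * norm (e w) \<partial>M) \<le> \<nu> * measure M S"
proof -
  note sq = second_moment_on_event[OF e bound]
  \<comment> \<open>The arithmetic-geometric mean inequality turns a bound on the second moment into one on the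
    first; the optimal parameter is \<nu>, approached by a limit if it is zero.\<close>
  have amgm: "norm v \<le> ((norm v)\<^sup>2 / t + t) / 2" if "t > 0" for t and v :: 'b
  proof -
    have "0 \<le> (norm v - t)\<^sup>2" by simp
    then show ?thesis using that by (simp add: power2_eq_square field_simps)
  qed
  show int: "integrable M (\<lambda>w. norm (e w))"
    by (rule Bochner_Integration.integrable_bound[where f = "\<lambda>w. ((norm (e w))\<^sup>2 / 1 + 1) / 2"])
      (use sq(1) amgm[of 1] in \<open>auto intro!: AE_I2\<close>)
  show "(\<integral>w. indicator S w * norm (e w) \<partial>M) \<le> \<nu> * measure M S" if S: "S \<in> sets F"
  proof -
    have [measurable]: "S \<in> sets M" using S subalg by (auto simp: subalgebra_def)
    have i2: "integrable M (\<lambda>w. indicator S w * (norm (e w))\<^sup>2)"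
      using integrable_mult_indicator[OF _ sq(1), of S] by simp
    have i1: "integrable M (\<lambda>w. indicator S w * norm (e w))"
      using integrable_mult_indicator[OF _ int, of S] by simp
    have i0: "integrable M (indicator S :: 'a \<Rightarrow> real)" by (simp add: emeasure_eq_measure)
    have *: "(\<integral>w. indicator S w * norm (e w) \<partial>M) \<le> (\<nu>\<^sup>2 / t + t) / 2 * measure M S" if t: "t > 0" for t
    proof -
      have "(\<integral>w. indicator S w * norm (e w) \<partial>M)
          \<le> (\<integral>w. (indicator S w * (norm (e w))\<^sup>2) * (1 / (2 * t)) + indicator S w * (t / 2) \<partial>M)"
      proof (rule integral_mono)
        show "indicator S w * norm (e w)
            \<le> (indicator S w * (norm (e w))\<^sup>2) * (1 / (2 * t)) + indicator S w * (t / 2)" for w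
          using amgm[OF t, of "e w"] by (simp add: indicator_def add_divide_distrib)
      qed (intro i0 i1 i2 Bochner_Integration.integrable_add integrable_mult_left)+
      also have "\<dots> = (\<integral>w. indicator S w * (norm (e w))\<^sup>2 \<partial>M) * (1 / (2 * t)) + measure M S * (t / 2)"
        using i0 i2 by (subst Bochner_Integration.integral_add) (auto intro!: integrable_mult_left)
      also have "\<dots> \<le> \<nu>\<^sup>2 * measure M S * (1 / (2 * t)) + measure M S * (t / 2)"
        using sq(2)[OF S] t by (intro add_right_mono mult_right_mono) auto
      finally show ?thesis by (simp add: field_simps)
    qed
    show ?thesis
    proof (cases "\<nu> = 0")
      case False
      then show ?thesis using *[of \<nu>] \<nu> by (simp add: power2_eq_square)
    next
      case True
      have "(\<integral>w. indicator S w * norm (e w) \<partial>M) \<le> 0"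
      proof (rule field_le_epsilon)
        fix d :: real assume d: "d > 0"
        define t where "t = d / (measure M S + 1)"
        have "t > 0" using d by (simp add: t_def add_nonneg_pos)
        have "(\<integral>w. indicator S w * norm (e w) \<partial>M) \<le> t / 2 * measure M S"
          using *[OF \<open>t > 0\<close>] True by simp
        also have "\<dots> \<le> t * (measure M S + 1)"
          using \<open>t > 0\<close> by (intro mult_mono) auto
        also have "\<dots> = d" using add_nonneg_pos[OF measure_nonneg[of M S], of 1] by (simp add: t_def)
        finally show "(\<integral>w. indicator S w * norm (e w) \<partial>M) \<le> 0 + d" by simp
      qed
      then show ?thesis using True by simp
    qed
  qed
qed

text \<open>A factor that is measurable with respect to the past can be pulled out of the conditional expectation,
coordinate by coordinate, so only the conditional mean of \<open>e\<close> is paired with \<open>h\<close>.\<close>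

lemma (in finite_measure_subalgebra) bias_on_event:
  fixes e h :: "'a \<Rightarrow> real ^ 'n"
  assumes e[measurable]: "e \<in> borel_measurable M" and int: "integrable M (\<lambda>w. norm (e w))"
    and bound: "AE w in M. norm (vec_cond_exp M F e w) \<le> \<mu>"
    and h: "h \<in> borel_measurable F" and hD: "\<And>w. w \<in> space M \<Longrightarrow> norm (h w) \<le> D"
    and \<mu>: "0 \<le> \<mu>" and S: "S \<in> sets F"
  shows "integrable M (\<lambda>w. indicator S w * (e w \<bullet> h w))"
    and "- (\<mu> * D * measure M S) \<le> (\<integral>w. indicator S w * (e w \<bullet> h w) \<partial>M)"
proof -
  have SM[measurable]: "S \<in> sets M" using S subalg by (auto simp: subalgebra_def)
  have hM[measurable]: "h \<in> borel_measurable M" by (rule measurable_from_subalg[OF subalg h])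
  have ej[measurable]: "(\<lambda>w. e w $ j) \<in> borel_measurable M" for j
    by (rule borel_measurable_continuous_on[OF _ e]) (intro continuous_intros)
  have hj[measurable]: "(\<lambda>w. h w $ j) \<in> borel_measurable F" for j
    by (rule borel_measurable_continuous_on[OF _ h]) (intro continuous_intros)
  have hjM[measurable]: "(\<lambda>w. h w $ j) \<in> borel_measurable M" for j
    by (rule measurable_from_subalg[OF subalg hj])
  have kj: "(\<lambda>w. indicator S w * h w $ j) \<in> borel_measurable F" for j
    using S by (intro borel_measurable_times hj) auto
  have bnd: "\<bar>h w $ j * e w $ j\<bar> \<le> D * norm (e w)" if "w \<in> space M" for w j
    unfolding abs_mult using component_le_norm_cart[of "h w" j] component_le_norm_cart[of "e w" j]
      hD[OF that] norm_ge_zero[of "h w"]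
    by (intro mult_mono) linarith+
  have intj: "integrable M (\<lambda>w. (indicator S w * h w $ j) * e w $ j)" for j
  proof (rule Bochner_Integration.integrable_bound[where f = "\<lambda>w. D * norm (e w)"])
    show "AE w in M. norm (indicator S w * h w $ j * e w $ j) \<le> norm (D * norm (e w))"
    proof (rule AE_I2)
      fix w assume w: "w \<in> space M"
      show "norm (indicator S w * h w $ j * e w $ j) \<le> norm (D * norm (e w))"
        using bnd[OF w, of j] by (auto simp: indicator_def)
    qed
  qed (use int in auto)
  have expand: "indicator S w * (v \<bullet> h w) = (\<Sum>j\<in>UNIV. (indicator S w * h w $ j) * v $ j)" for w v
    by (simp add: inner_vec_def sum_distrib_left algebra_simps)
  show "integrable M (\<lambda>w. indicator S w * (e w \<bullet> h w))"
    unfolding expand using intj by (intro Bochner_Integration.integrable_sum)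
  note ce = real_cond_exp_intg[OF intj kj ej]
  let ?c = "vec_cond_exp M F e"
  have intc: "integrable M (\<lambda>w. indicator S w * (?c w \<bullet> h w))"
    unfolding expand using ce(1) by (auto intro!: Bochner_Integration.integrable_sum simp: vec_cond_exp_def)
  have "(\<integral>w. indicator S w * (e w \<bullet> h w) \<partial>M) = (\<integral>w. indicator S w * (?c w \<bullet> h w) \<partial>M)"
    unfolding expand using intj ce
    by (simp add: Bochner_Integration.integral_sum vec_cond_exp_def)
  moreover have "(\<integral>w. indicator S w * (- (\<mu> * D)) \<partial>M) \<le> (\<integral>w. indicator S w * (?c w \<bullet> h w) \<partial>M)"
  proof (rule integral_mono_AE)
    show "integrable M (\<lambda>w. indicator S w * (- (\<mu> * D)) :: real)"
      by (intro integrable_mult_left) (simp add: emeasure_eq_measure)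
    show "AE w in M. indicator S w * (- (\<mu> * D)) \<le> indicator S w * (?c w \<bullet> h w)"
      using bound AE_space
    proof eventually_elim
      case (elim w)
      have "\<bar>?c w \<bullet> h w\<bar> \<le> norm (?c w) * norm (h w)" by (rule Cauchy_Schwarz_ineq2)
      also have "\<dots> \<le> \<mu> * D" using elim hD \<mu> by (intro mult_mono) auto
      finally show ?case by (auto simp: indicator_def)
    qed
  qed (rule intc)
  ultimately show "- (\<mu> * D * measure M S) \<le> (\<integral>w. indicator S w * (e w \<bullet> h w) \<partial>M)" by (simp add: mult.commute)
qed

section \<open>The stochastic method\<close>

text \<open>Only the suprema of step-dependent bounds on the conditional bias and noise enter the result, so \<open>\<mu>\<close>
and \<open>\<nu>\<close> stand for common bounds from the start.\<close>

locale incremental_stochastic_subgradient = prob_space M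
  for M :: "'w measure" +
  fixes X :: "(real ^ 'n) set"
    and m :: nat
    and f :: "nat \<Rightarrow> real ^ 'n \<Rightarrow> real"
    and C :: "nat \<Rightarrow> real"
    and \<alpha> \<mu> \<nu> :: real
    and x :: "nat \<Rightarrow> 'w \<Rightarrow> real ^ 'n"
    and z g \<epsilon> :: "nat \<Rightarrow> nat \<Rightarrow> 'w \<Rightarrow> real ^ 'n"
  assumes X: "convex X" "closed X" "X \<noteq> {}" and bounded_X: "bounded X"
    and convex_f: "\<And>i. i \<in> {1..m} \<Longrightarrow> convex_on UNIV (f i)"
    and subgradient_bound:
      "\<And>i y v. i \<in> {1..m} \<Longrightarrow> y \<in> X \<Longrightarrow> is_subgradient (f i) v y \<Longrightarrow> norm v \<le> C i"
    and stepsize_pos: "\<alpha> > 0"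
    and start_measurable [measurable]: "x 0 \<in> borel_measurable M"
    and start_in_X: "\<And>w. w \<in> space M \<Longrightarrow> x 0 w \<in> X"
    and error_measurable [measurable]:
      "\<And>i k. i \<in> {1..m} \<Longrightarrow> k \<ge> 1 \<Longrightarrow> \<epsilon> i k \<in> borel_measurable M"
    and cycle_start: "\<And>k w. w \<in> space M \<Longrightarrow> z 0 (k + 1) w = x k w"
    and cycle_subgradient: "\<And>i k w. i \<in> {1..m} \<Longrightarrow> w \<in> space M \<Longrightarrow>
      is_subgradient (f i) (g i (k + 1) w) (z (i - 1) (k + 1) w)"
    and cycle_step: "\<And>i k w. i \<in> {1..m} \<Longrightarrow> w \<in> space M \<Longrightarrow> z i (k + 1) w =
      closest_point X (z (i - 1) (k + 1) w - \<alpha> *\<^sub>R (g i (k + 1) w + \<epsilon> i (k + 1) w))"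
    and cycle_end: "\<And>k w. w \<in> space M \<Longrightarrow> x (k + 1) w = z m (k + 1) w"
    and adapted: "\<And>i k. i \<in> {1..m} \<Longrightarrow> k \<ge> 1 \<Longrightarrow>
      z i k \<in> borel_measurable (history M m (x 0) \<epsilon> k i)"
    and bias_nonneg: "\<mu> \<ge> 0" and noise_nonneg: "\<nu> \<ge> 0"
    and bias_bound: "\<And>i k. i \<in> {1..m} \<Longrightarrow> k \<ge> 1 \<Longrightarrow>
      AE w in M. norm (vec_cond_exp M (history M m (x 0) \<epsilon> k (i - 1)) (\<epsilon> i k) w) \<le> \<mu>"
    and noise_bound: "\<And>i k. i \<in> {1..m} \<Longrightarrow> k \<ge> 1 \<Longrightarrow>
      AE w in M. nn_cond_exp M (history M m (x 0) \<epsilon> k (i - 1))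
        (\<lambda>u. ennreal ((norm (\<epsilon> i k u))\<^sup>2)) w \<le> ennreal (\<nu>\<^sup>2)"
begin

abbreviation past :: "nat \<Rightarrow> nat \<Rightarrow> 'w measure" where
  "past k i \<equiv> history M m (x 0) \<epsilon> k i"

definition objective :: "real ^ 'n \<Rightarrow> real" where
  "objective y = (\<Sum>i=1..m. f i y)"

definition tolerance :: real where
  "tolerance = real m * \<mu> * diameter X + \<alpha> / 2 * ((\<Sum>i=1..m. C i) + real m * \<nu>)\<^sup>2"

lemma space_past [simp]: "space (past k i) = space M"
  unfolding history_def by (rule space_measure_of) auto

lemma sets_past:
  "sets (past k i) = sigma_sets (space M)
     ({x 0 -` A \<inter> space M | A. A \<in> sets borel} \<union>
      {\<epsilon> j l -` A \<inter> space M | j l A.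
         A \<in> sets borel \<and> 1 \<le> l \<and> 1 \<le> j \<and> (l < k \<and> j \<le> m \<or> l = k \<and> j \<le> i)})"
  unfolding history_def by (rule sets_measure_of) auto

lemma subalgebra_past:
  assumes "i \<le> m"
  shows "subalgebra M (past k i)"
proof -
  have "x 0 -` A \<inter> space M \<in> sets M" if "A \<in> sets borel" for A
    using measurable_sets[OF start_measurable that] .
  moreover have "\<epsilon> j l -` A \<inter> space M \<in> sets M"
    if "A \<in> sets borel" "1 \<le> l" "1 \<le> j" "l < k \<and> j \<le> m \<or> l = k \<and> j \<le> i" for j l A
    using that assms by (intro measurable_sets[OF error_measurable that(1)]) auto
  ultimately show ?thesis
    unfolding subalgebra_def sets_past by (auto intro!: sets.sigma_sets_subset)
qed

lemma finite_measure_subalgebra_past: "i \<le> m \<Longrightarrow> finite_measure_subalgebra M (past k i)"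
  by (intro finite_measure_subalgebra.intro finite_measure_subalgebra_axioms.intro
      finite_measure_axioms subalgebra_past)

lemma sets_past_mono:
  assumes "k < k' \<and> i \<le> m \<or> k = k' \<and> i \<le> i'"
  shows "sets (past k i) \<subseteq> sets (past k' i')"
  unfolding sets_past
proof (intro sigma_sets_mono' Un_mono order_refl subsetI, elim CollectE exE conjE)
  fix B j l A
  assume B: "B = \<epsilon> j l -` A \<inter> space M" "A \<in> sets borel" "1 \<le> l" "1 \<le> j"
    "l < k \<and> j \<le> m \<or> l = k \<and> j \<le> i"
  then have "l < k' \<and> j \<le> m \<or> l = k' \<and> j \<le> i'" using assms by auto
  with B show "B \<in> {\<epsilon> j l -` A \<inter> space M | j l A.
         A \<in> sets borel \<and> 1 \<le> l \<and> 1 \<le> j \<and> (l < k' \<and> j \<le> m \<or> l = k' \<and> j \<le> i')}" by blast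
qed

lemma measurable_past_mono:
  assumes "h \<in> borel_measurable (past k i)" "k < k' \<and> i \<le> m \<or> k = k' \<and> i \<le> i'"
  shows "h \<in> borel_measurable (past k' i')"
  using assms sets_past_mono[OF assms(2)] unfolding measurable_def by auto

lemma iterate_measurable: "x k \<in> borel_measurable (past (k + 1) 0)"
proof (induction k)
  case 0
  have "x 0 -` A \<inter> space M \<in> sets (past 1 0)" if "A \<in> sets borel" for A
    unfolding sets_past using that by (intro sigma_sets.Basic) auto
  then show ?case by (simp add: measurable_def)
next
  case (Suc k)
  have "x (Suc k) \<in> borel_measurable (past (k + 1) m)"
  \<comment> \<open>A cycle without inner steps does nothing, so the iterate is not the outcome of an adapted step.\<close>
  proof (cases "m = 0")
    case True
    have "x (Suc k) w = x k w" if "w \<in> space (past (k + 1) 0)" for w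
      using that[unfolded space_past] cycle_end[of w k] cycle_start[of w k] True by simp
    from measurable_cong[THEN iffD2, OF this Suc.IH] show ?thesis using True by simp
  next
    case False
    have "x (Suc k) w = z m (k + 1) w" if "w \<in> space (past (k + 1) m)" for w
      using that cycle_end[of w k] by simp
    from measurable_cong[THEN iffD2, OF this adapted] show ?thesis using False by simp
  qed
  then show ?case by (rule measurable_past_mono) simp
qed

lemma inner_iterate_measurable:
  assumes "i \<in> {1..m}"
  shows "z (i - 1) (k + 1) \<in> borel_measurable (past (k + 1) (i - 1))"
proof (cases "i = 1")
  case True
  have "z 0 (k + 1) w = x k w" if "w \<in> space (past (k + 1) 0)" for w
    using that cycle_start by simp
  from measurable_cong[THEN iffD2, OF this iterate_measurable] show ?thesis using True by simp
next
  case False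
  then show ?thesis using assms by (intro adapted) auto
qed

lemma iterate_measurable_M [measurable]: "x k \<in> borel_measurable M"
  using measurable_from_subalg[OF subalgebra_past iterate_measurable] by simp

lemma objective_continuous: "continuous_on A objective"
proof -
  have "continuous_on UNIV (f i)" if "i \<in> {1..m}" for i
    using convex_on_continuous[OF _ convex_f[OF that]] by simp
  then have "continuous_on UNIV objective"
    unfolding objective_def[abs_def] by (intro continuous_on_sum) auto
  then show ?thesis by (rule continuous_on_subset) simp
qed

lemma objective_measurable [measurable]: "objective \<in> borel_measurable borel"
  by (rule borel_measurable_continuous_onI[OF objective_continuous])

lemma inner_iterate_in_X:
  assumes w: "w \<in> space M" and xk: "x k w \<in> X" and i: "i \<le> m"
  shows "z i (k + 1) w \<in> X"
proof (cases "i = 0")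
  case True
  then show ?thesis using cycle_start[OF w] xk by simp
next
  case False
  then show ?thesis
    using i cycle_step[of i w k] w closest_point_in_set[OF X(2,3)] by simp
qed

lemma iterate_in_X: "w \<in> space M \<Longrightarrow> x k w \<in> X"
proof (induction k)
  case (Suc k)
  then show ?case using inner_iterate_in_X[of w k m] cycle_end[of w k] by simp
qed (rule start_in_X)

lemma norm_diff_le_diameter: "u \<in> X \<Longrightarrow> y \<in> X \<Longrightarrow> norm (u - y) \<le> diameter X"
  using diameter_bounded_bound[OF bounded_X] by (simp add: dist_norm)

lemma subgradient_bound_nonneg:
  assumes i: "i \<in> {1..m}"
  shows "0 \<le> C i"
proof -
  obtain y where y: "y \<in> X" using X(3) by blast
  show ?thesis
    using convex_subgradient_exists[OF convex_f[OF i], of y] subgradient_bound[OF i y]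
      norm_ge_zero order_trans by blast
qed

lemma integrable_objective:
  assumes [measurable]: "S \<in> sets M"
  shows "integrable M (\<lambda>w. indicator S w * objective (x k w))"
proof -
  have "compact (objective ` X)"
    using X(2) bounded_X by (intro compact_continuous_image objective_continuous)
      (simp add: compact_eq_bounded_closed)
  then have "bounded (objective ` X)" by (rule compact_imp_bounded)
  then obtain B where B: "\<And>y. y \<in> X \<Longrightarrow> \<bar>objective y\<bar> \<le> B"
    unfolding bounded_iff by auto
  have "\<bar>indicator S w * objective (x k w)\<bar> \<le> B" if "w \<in> space M" for w
    using B[OF iterate_in_X[OF that], of k] by (auto simp: indicator_def)
  then show ?thesis by (intro integrable_const_bound[where B = B]) (auto intro!: AE_I2)
qed

lemma integrable_distance:
  assumes [measurable]: "S \<in> sets M" and y: "y \<in> X"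
  shows "integrable M (\<lambda>w. indicator S w * (norm (x k w - y))\<^sup>2)"
proof -
  have "\<bar>indicator S w * (norm (x k w - y))\<^sup>2\<bar> \<le> (diameter X)\<^sup>2" if "w \<in> space M" for w
    using power_mono[OF norm_diff_le_diameter[OF iterate_in_X[OF that, of k] y], of 2]
    by (auto simp: indicator_def)
  then show ?thesis by (intro integrable_const_bound[where B = "(diameter X)\<^sup>2"]) (auto intro!: AE_I2)
qed

text \<open>The deterministic descent over one cycle is integrated over an event \<open>S\<close> of the past. Each inner step
contributes at most \<open>\<mu>\<close> times the diameter through its bias, and the drift and the squared steps complete
the square of \<open>(\<Sum>i=1..m. C i) + real m * \<nu>\<close>; together they make up \<open>2 * \<alpha> * tolerance\<close>
times the probability of \<open>S\<close>. Allowing an event, rather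
than taking only the full expectation, is what yields the almost sure statement.\<close>

lemma expected_cycle_descent:
  assumes y: "y \<in> X" and S: "S \<in> sets (past (k + 1) 0)"
  shows "(\<integral>w. indicator S w * (norm (x (k + 1) w - y))\<^sup>2 \<partial>M)
    \<le> (\<integral>w. indicator S w * (norm (x k w - y))\<^sup>2 \<partial>M)
      - 2 * \<alpha> * ((\<integral>w. indicator S w * objective (x k w) \<partial>M)
          - (objective y + tolerance) * prob S)"
proof -
  let ?D = "diameter X" and ?P = "prob S"
  let ?b = "\<lambda>i w. indicator S w * (\<epsilon> i (k + 1) w \<bullet> (z (i - 1) (k + 1) w - y))"
  let ?n = "\<lambda>i w. indicator S w * norm (\<epsilon> i (k + 1) w)"
  let ?q = "\<lambda>i w. indicator S w * (norm (\<epsilon> i (k + 1) w))\<^sup>2"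
  have SM[measurable]: "S \<in> sets M" using S subalgebra_past[of 0] by (auto simp: subalgebra_def)
  have iS: "integrable M (indicator S :: 'w \<Rightarrow> real)" by (simp add: emeasure_eq_measure)
  have noise: "integrable M (?n i)" "(\<integral>w. ?n i w \<partial>M) \<le> \<nu> * ?P"
    "integrable M (?q i)" "(\<integral>w. ?q i w \<partial>M) \<le> \<nu>\<^sup>2 * ?P"
    "integrable M (?b i)" "- (\<mu> * ?D * ?P) \<le> (\<integral>w. ?b i w \<partial>M)"
    if i: "i \<in> {1..m}" for i
  proof -
    interpret fm: finite_measure_subalgebra M "past (k + 1) (i - 1)"
      using i by (intro finite_measure_subalgebra_past) auto
    have Si: "S \<in> sets (past (k + 1) (i - 1))"
      using S sets_past_mono[of "k + 1" "k + 1" 0 "i - 1"] by auto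
    have e: "\<epsilon> i (k + 1) \<in> borel_measurable M" using error_measurable[OF i, of "k + 1"] by simp
    have nb: "AE w in M. nn_cond_exp M (past (k + 1) (i - 1))
        (\<lambda>u. ennreal ((norm (\<epsilon> i (k + 1) u))\<^sup>2)) w \<le> ennreal (\<nu>\<^sup>2)"
      using noise_bound[OF i, of "k + 1"] by simp
    have bb: "AE w in M. norm (vec_cond_exp M (past (k + 1) (i - 1)) (\<epsilon> i (k + 1)) w) \<le> \<mu>"
      using bias_bound[OF i, of "k + 1"] by simp
    have h: "(\<lambda>w. z (i - 1) (k + 1) w - y) \<in> borel_measurable (past (k + 1) (i - 1))"
      using inner_iterate_measurable[OF i] by (intro borel_measurable_diff) auto
    have hD: "norm (z (i - 1) (k + 1) w - y) \<le> ?D" if "w \<in> space M" for w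
      using i that by (intro norm_diff_le_diameter inner_iterate_in_X iterate_in_X y) auto
    note one = fm.first_moment_on_event[OF e noise_nonneg nb]
    note two = fm.second_moment_on_event[OF e nb]
    note b = fm.bias_on_event[OF e one(1) bb h hD bias_nonneg Si]
    show "integrable M (?n i)" using integrable_mult_indicator[OF SM one(1)] by simp
    show "integrable M (?q i)" using integrable_mult_indicator[OF SM two(1)] by simp
    show "(\<integral>w. ?n i w \<partial>M) \<le> \<nu> * ?P" by (rule one(2)[OF Si])
    show "(\<integral>w. ?q i w \<partial>M) \<le> \<nu>\<^sup>2 * ?P" by (rule two(2)[OF Si])
    show "integrable M (?b i)" "- (\<mu> * ?D * ?P) \<le> (\<integral>w. ?b i w \<partial>M)" using b by auto
  qed
  \<comment> \<open>The bound of the deterministic descent splits, after multiplication by the indicator, into the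
    gain L, the bias terms b and the quadratic noise terms N with the square expanded.\<close>
  let ?L = "\<lambda>w. indicator S w * (norm (x k w - y))\<^sup>2
      - 2 * \<alpha> * (indicator S w * objective (x k w) - objective y * indicator S w)"
  let ?N = "\<lambda>i w. 2 * C i * (\<Sum>j=1..<i. C j * indicator S w + ?n j w)
      + ((C i)\<^sup>2 * indicator S w + 2 * C i * ?n i w + ?q i w)"
  have intL: "integrable M ?L"
    using integrable_distance[OF SM y] integrable_objective[OF SM] iS by auto
  have LI: "(\<integral>w. ?L w \<partial>M) = (\<integral>w. indicator S w * (norm (x k w - y))\<^sup>2 \<partial>M)
      - 2 * \<alpha> * ((\<integral>w. indicator S w * objective (x k w) \<partial>M) - objective y * ?P)"
    using integrable_distance[OF SM y] integrable_objective[OF SM] iS by simp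
  have intj: "integrable M (\<lambda>w. \<Sum>j=1..<i. C j * indicator S w + ?n j w)" if "i \<in> {1..m}" for i
    using that iS by (intro Bochner_Integration.integrable_sum Bochner_Integration.integrable_add
        integrable_mult_right noise) auto
  have Ij: "(\<integral>w. (\<Sum>j=1..<i. C j * indicator S w + ?n j w) \<partial>M) \<le> (\<Sum>j=1..<i. C j + \<nu>) * ?P"
    if i: "i \<in> {1..m}" for i
  proof -
    have "(\<integral>w. (\<Sum>j=1..<i. C j * indicator S w + ?n j w) \<partial>M)
        = (\<Sum>j=1..<i. \<integral>w. C j * indicator S w + ?n j w \<partial>M)"
      using i iS by (intro Bochner_Integration.integral_sum Bochner_Integration.integrable_add
        integrable_mult_right noise) auto
    also have "\<dots> \<le> (\<Sum>j=1..<i. (C j + \<nu>) * ?P)"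
    proof (rule sum_mono)
      fix j assume "j \<in> {1..<i}"
      then have j: "j \<in> {1..m}" using i by auto
      show "(\<integral>w. C j * indicator S w + ?n j w \<partial>M) \<le> (C j + \<nu>) * ?P"
        using iS noise(1,2)[OF j] by (simp add: algebra_simps)
    qed
    finally show ?thesis by (simp add: sum_distrib_right)
  qed
  have intN: "integrable M (?N i)" if i: "i \<in> {1..m}" for i
    using i iS by (intro Bochner_Integration.integrable_add integrable_mult_right noise intj)
  have NI: "(\<integral>w. ?N i w \<partial>M) \<le> (2 * (C i + \<nu>) * (\<Sum>j=1..<i. C j + \<nu>) + (C i + \<nu>)\<^sup>2) * ?P"
    if i: "i \<in> {1..m}" for i
  proof -
    have s0: "0 \<le> (\<Sum>j=1..<i. C j + \<nu>)"
      using i subgradient_bound_nonneg noise_nonneg by (intro sum_nonneg add_nonneg_nonneg) auto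
    have "(\<integral>w. ?N i w \<partial>M) = 2 * C i * (\<integral>w. (\<Sum>j=1..<i. C j * indicator S w + ?n j w) \<partial>M)
        + ((C i)\<^sup>2 * ?P + 2 * C i * (\<integral>w. ?n i w \<partial>M) + (\<integral>w. ?q i w \<partial>M))"
      using iS noise(1,3)[OF i] intj[OF i] by simp
    also have "\<dots> \<le> 2 * C i * ((\<Sum>j=1..<i. C j + \<nu>) * ?P)
        + ((C i)\<^sup>2 * ?P + 2 * C i * (\<nu> * ?P) + \<nu>\<^sup>2 * ?P)"
      using Ij[OF i] noise(2,4)[OF i] subgradient_bound_nonneg[OF i]
      by (intro add_mono mult_left_mono order_refl) auto
    also have "\<dots> \<le> 2 * (C i + \<nu>) * ((\<Sum>j=1..<i. C j + \<nu>) * ?P)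
        + ((C i)\<^sup>2 * ?P + 2 * C i * (\<nu> * ?P) + \<nu>\<^sup>2 * ?P)"
      using s0 noise_nonneg by (intro add_right_mono mult_right_mono) auto
    finally show ?thesis by (simp add: algebra_simps power2_eq_square)
  qed
  have pointwise: "indicator S w * (norm (x (k + 1) w - y))\<^sup>2
      \<le> ?L w - 2 * \<alpha> * (\<Sum>i=1..m. ?b i w) + \<alpha>\<^sup>2 * (\<Sum>i=1..m. ?N i w)"
    if w: "w \<in> space M" for w
  proof (cases "w \<in> S")
    case True
    have "(norm (z m (k + 1) w - y))\<^sup>2 \<le> (norm (z 0 (k + 1) w - y))\<^sup>2
      - 2 * \<alpha> * ((\<Sum>i=1..m. f i (z 0 (k + 1) w)) - (\<Sum>i=1..m. f i y))
      - 2 * \<alpha> * (\<Sum>i=1..m. \<epsilon> i (k + 1) w \<bullet> (z (i - 1) (k + 1) w - y))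
      + \<alpha>\<^sup>2 * (\<Sum>i=1..m. 2 * C i * (\<Sum>j=1..<i. C j + norm (\<epsilon> j (k + 1) w))
          + (C i + norm (\<epsilon> i (k + 1) w))\<^sup>2)"
    proof (rule incremental_cycle_descent[OF X y, where f = f and C = C and m = m and \<alpha> = \<alpha>
          and z = "\<lambda>i. z i (k + 1) w" and g = "\<lambda>i. g i (k + 1) w" and e = "\<lambda>i. \<epsilon> i (k + 1) w"])
      show "z 0 (k + 1) w \<in> X" using inner_iterate_in_X[OF w iterate_in_X[OF w]] by simp
    qed (use stepsize_pos convex_f subgradient_bound cycle_subgradient[OF _ w] cycle_step[OF _ w]
        in auto)
    then show ?thesis
      using True cycle_end[OF w, of k] cycle_start[OF w, of k]
      by (simp add: objective_def power2_sum add_ac)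
  qed simp
  let ?R = "\<lambda>w. ?L w - 2 * \<alpha> * (\<Sum>i=1..m. ?b i w) + \<alpha>\<^sup>2 * (\<Sum>i=1..m. ?N i w)"
  have sb: "integrable M (\<lambda>w. \<Sum>i=1..m. ?b i w)" and sN: "integrable M (\<lambda>w. \<Sum>i=1..m. ?N i w)"
    using noise(5) intN by (intro Bochner_Integration.integrable_sum; blast)+
  have intR: "integrable M ?R"
    by (rule Bochner_Integration.integrable_add[OF Bochner_Integration.integrable_diff[OF intL
          integrable_mult_right[OF sb]] integrable_mult_right[OF sN]])
  have "(\<integral>w. indicator S w * (norm (x (k + 1) w - y))\<^sup>2 \<partial>M) \<le> (\<integral>w. ?R w \<partial>M)"
    by (rule integral_mono[OF integrable_distance[OF SM y] intR pointwise])
  also have "\<dots> = (\<integral>w. ?L w \<partial>M) - 2 * \<alpha> * (\<integral>w. (\<Sum>i=1..m. ?b i w) \<partial>M)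
      + \<alpha>\<^sup>2 * (\<integral>w. (\<Sum>i=1..m. ?N i w) \<partial>M)"
    using Bochner_Integration.integral_add[OF Bochner_Integration.integrable_diff[OF intL
          integrable_mult_right[OF sb, of "2 * \<alpha>"]] integrable_mult_right[OF sN, of "\<alpha>\<^sup>2"]]
      Bochner_Integration.integral_diff[OF intL integrable_mult_right[OF sb, of "2 * \<alpha>"]]
    by (simp only: integral_mult_right_zero)
  also have "(\<integral>w. (\<Sum>i=1..m. ?b i w) \<partial>M) = (\<Sum>i=1..m. \<integral>w. ?b i w \<partial>M)"
    using noise(5) by (intro Bochner_Integration.integral_sum)
  also have "(\<integral>w. (\<Sum>i=1..m. ?N i w) \<partial>M) = (\<Sum>i=1..m. \<integral>w. ?N i w \<partial>M)"
    using intN by (intro Bochner_Integration.integral_sum)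
  also have "(\<integral>w. ?L w \<partial>M) - 2 * \<alpha> * (\<Sum>i=1..m. \<integral>w. ?b i w \<partial>M) + \<alpha>\<^sup>2 * (\<Sum>i=1..m. \<integral>w. ?N i w \<partial>M)
      \<le> (\<integral>w. ?L w \<partial>M) - 2 * \<alpha> * (- (real m * (\<mu> * ?D * ?P)))
        + \<alpha>\<^sup>2 * (((\<Sum>i=1..m. C i) + real m * \<nu>)\<^sup>2 * ?P)"
  proof -
    have "(\<Sum>i=1..m. - (\<mu> * ?D * ?P)) \<le> (\<Sum>i=1..m. \<integral>w. ?b i w \<partial>M)"
      by (rule sum_mono) (rule noise(6))
    then have "- (real m * (\<mu> * ?D * ?P)) \<le> (\<Sum>i=1..m. \<integral>w. ?b i w \<partial>M)" by simp
    moreover have "(\<Sum>i=1..m. \<integral>w. ?N i w \<partial>M) \<le> ((\<Sum>i=1..m. C i) + real m * \<nu>)\<^sup>2 * ?P"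
    proof -
      have "(\<Sum>i=1..m. \<integral>w. ?N i w \<partial>M)
          \<le> (\<Sum>i=1..m. (2 * (C i + \<nu>) * (\<Sum>j=1..<i. C j + \<nu>) + (C i + \<nu>)\<^sup>2) * ?P)"
        by (rule sum_mono) (rule NI)
      also have "\<dots> = (\<Sum>i=1..m. C i + \<nu>)\<^sup>2 * ?P"
        unfolding sum_square_triangular by (simp only: sum_distrib_right)
      finally show ?thesis by (simp add: sum.distrib)
    qed
    ultimately show ?thesis
      using stepsize_pos by (intro add_mono diff_left_mono mult_left_mono) auto
  qed
  also have "\<dots> = (\<integral>w. indicator S w * (norm (x k w - y))\<^sup>2 \<partial>M)
      - 2 * \<alpha> * ((\<integral>w. indicator S w * objective (x k w) \<partial>M) - (objective y + tolerance) * ?P)"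
    unfolding LI tolerance_def by (simp add: field_simps power2_eq_square)
  finally show ?thesis .
qed

text \<open>As long as the objective averages more than \<open>objective y + tolerance\<close> on \<open>S k\<close>, with a margin \<open>\<delta>\<close>, each cycle
lowers the squared distance to \<open>y\<close>, integrated over \<open>S k\<close>, by at least \<open>2 * \<alpha> * \<delta>\<close> times the probability of
the intersection. A nonnegative quantity cannot decrease forever by a fixed positive amount.\<close>

lemma persistent_event_null:
  assumes y: "y \<in> X" and \<delta>: "\<delta> > 0"
    and S: "\<And>k. S k \<in> sets (past (k + 1) 0)" and dec: "decseq S"
    and high: "\<And>k. k \<ge> N \<Longrightarrow> (objective y + tolerance + \<delta>) * prob (S k)
      \<le> (\<integral>w. indicator (S k) w * objective (x k w) \<partial>M)"
  shows "prob (\<Inter>k. S k) = 0"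
proof (rule ccontr)
  define p where "p = prob (\<Inter>k. S k)"
  define V where "V k = (\<integral>w. indicator (S k) w * (norm (x k w - y))\<^sup>2 \<partial>M)" for k
  assume "prob (\<Inter>k. S k) \<noteq> 0"
  then have p: "p > 0" by (simp add: p_def zero_less_measure_iff)
  have SM: "S k \<in> sets M" for k using S[of k] subalgebra_past[of 0] by (auto simp: subalgebra_def)
  have V0: "V k \<ge> 0" for k unfolding V_def by (intro Bochner_Integration.integral_nonneg) auto
  have step: "V (Suc k) \<le> V k - 2 * \<alpha> * \<delta> * p" if k: "k \<ge> N" for k
  proof -
    \<comment> \<open>Shrinking the event can only decrease the integral of a nonnegative function.\<close>
    have sub: "S (Suc k) \<subseteq> S k" using dec by (simp add: decseq_SucD)
    have "V (Suc k) \<le> (\<integral>w. indicator (S k) w * (norm (x (k + 1) w - y))\<^sup>2 \<partial>M)"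
      unfolding V_def using sub integrable_distance[OF SM y, of _ "Suc k"]
      by (intro integral_mono) (auto simp: indicator_def)
    also have "\<dots> \<le> V k - 2 * \<alpha> * ((\<integral>w. indicator (S k) w * objective (x k w) \<partial>M)
          - (objective y + tolerance) * prob (S k))"
      unfolding V_def by (rule expected_cycle_descent[OF y S])
    also have "\<dots> \<le> V k - 2 * \<alpha> * (\<delta> * p)"
    proof -
      have "p \<le> prob (S k)" unfolding p_def by (intro finite_measure_mono SM) auto
      then have "\<delta> * p \<le> \<delta> * prob (S k)" using \<delta> by simp
      also have "\<dots> \<le> (\<integral>w. indicator (S k) w * objective (x k w) \<partial>M)
          - (objective y + tolerance) * prob (S k)"
        using high[OF k] by (simp add: algebra_simps)
      finally show ?thesis using stepsize_pos by (intro diff_left_mono mult_left_mono) auto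
    qed
    finally show ?thesis by (simp add: mult.assoc)
  qed
  have "V (N + n) \<le> V N - real n * (2 * \<alpha> * \<delta> * p)" for n
  proof (induction n)
    case (Suc n)
    then show ?case using step[of "N + n"] by (simp add: algebra_simps)
  qed simp
  then have "real n * (2 * \<alpha> * \<delta> * p) \<le> V N" for n
    using V0[of "N + n"] by (smt (verit))
  moreover have "2 * \<alpha> * \<delta> * p > 0" using stepsize_pos \<delta> p by simp
  ultimately show False using reals_Archimedean3 by (meson not_le)
qed

lemma near_minimizer:
  assumes "(INF y\<in>X. objective y) < c"
  obtains y where "y \<in> X" "objective y < c"
  using cInf_lessD[OF _ assms] X(3) by auto

text \<open>If the expectations eventually exceeded a larger level, \<open>persistent_event_null\<close> would apply to the whole
space and give it probability zero.\<close>

theorem liminf_expected_objective: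
  "liminf (\<lambda>k. ereal (\<integral>w. objective (x k w) \<partial>M)) \<le> ereal ((INF y\<in>X. objective y) + tolerance)"
proof (rule ccontr)
  let ?B = "(INF y\<in>X. objective y) + tolerance"
  assume "\<not> ?thesis"
  then obtain r where r: "?B < r"
    "ereal r < liminf (\<lambda>k. ereal (\<integral>w. objective (x k w) \<partial>M))"
    using ereal_dense2 by (metis less_ereal.simps(1) not_le)
  from less_LiminfD[OF r(2)] obtain N where N: "\<And>k. k \<ge> N \<Longrightarrow> r < (\<integral>w. objective (x k w) \<partial>M)"
    by (auto simp: eventually_sequentially)
  \<comment> \<open>Half of the gap absorbs the failure of y to be an exact minimizer, half remains as the margin.\<close>
  define \<delta> where "\<delta> = (r - ?B) / 2"
  have \<delta>: "\<delta> > 0" using r by (simp add: \<delta>_def)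
  obtain y where y: "y \<in> X" "objective y < (INF y\<in>X. objective y) + \<delta>"
    using near_minimizer[of "(INF y\<in>X. objective y) + \<delta>"] \<delta> by auto
  have "prob (\<Inter>k::nat. space M) = 0"
  proof (rule persistent_event_null[OF y(1) \<delta>, where S = "\<lambda>_. space M" and N = N])
    show "space M \<in> sets (past (k + 1) 0)" for k by (metis sets.top space_past)
    show "decseq (\<lambda>_::nat. space M)" by (simp add: decseq_def)
    fix k assume "k \<ge> N"
    have "(\<integral>w. indicator (space M) w * objective (x k w) \<partial>M) = (\<integral>w. objective (x k w) \<partial>M)"
      by (intro Bochner_Integration.integral_cong) auto
    then show "(objective y + tolerance + \<delta>) * prob (space M)
        \<le> (\<integral>w. indicator (space M) w * objective (x k w) \<partial>M)"
      using N[OF \<open>k \<ge> N\<close>] y(2) by (simp add: prob_space \<delta>_def field_simps)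
  qed
  then show False by (simp add: prob_space)
qed

text \<open>For each margin, the events that the objective has exceeded the level at all iterates so far are decreasing
and known to the past, so their intersection is null; countably many margins suffice.\<close>

theorem inf_objective_almost_surely:
  "AE w in M. (INF k. ereal (objective (x k w))) \<le> ereal ((INF y\<in>X. objective y) + tolerance)"
proof -
  let ?B = "(INF y\<in>X. objective y) + tolerance"
  have "AE w in M. \<exists>k. objective (x k w) < ?B + \<delta>" if \<delta>: "\<delta> > 0" for \<delta> :: real
  proof -
    obtain y where y: "y \<in> X" "objective y < (INF y\<in>X. objective y) + \<delta> / 2"
      using near_minimizer[of "(INF y\<in>X. objective y) + \<delta> / 2"] \<delta> by auto
    \<comment> \<open>This event is known before cycle k + 1 starts, since that cycle starts from iterate k.\<close>
    define S where "S k = {w \<in> space M. \<forall>j\<in>{..k}. ?B + \<delta> \<le> objective (x j w)}" for k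
    have S: "S k \<in> sets (past (k + 1) 0)" for k
    proof -
      have meas: "(\<lambda>w. objective (x j w)) \<in> borel_measurable (past (k + 1) 0)"
        if "j \<in> {..k}" for j
      proof (rule measurable_compose[OF _ objective_measurable])
        show "x j \<in> borel_measurable (past (k + 1) 0)"
          by (rule measurable_past_mono[OF iterate_measurable]) (use that in auto)
      qed
      have "{w \<in> space (past (k + 1) 0). \<forall>j\<in>{..k}. ?B + \<delta> \<le> objective (x j w)}
          \<in> sets (past (k + 1) 0)"
        by (rule sets.sets_Collect_finite_All) (use borel_measurable_le[OF borel_measurable_const meas] in auto)
      then show ?thesis by (simp add: S_def)
    qed
    have SM: "S k \<in> sets M" for k using S[of k] subalgebra_past[of 0] by (auto simp: subalgebra_def)
    have "prob (\<Inter>k. S k) = 0"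
    proof (rule persistent_event_null[OF y(1) _ S, where \<delta> = "\<delta> / 2" and N = 0])
      show "decseq S" by (rule decseq_SucI) (auto simp: S_def)
      fix k
      have "(objective y + tolerance + \<delta> / 2) * prob (S k)
          = (\<integral>w. indicator (S k) w * (objective y + tolerance + \<delta> / 2) \<partial>M)"
        using sets.sets_into_space[OF SM] by (simp add: Int_absorb2 mult.commute)
      also have "\<dots> \<le> (\<integral>w. indicator (S k) w * objective (x k w) \<partial>M)"
      proof (rule integral_mono)
        show "integrable M (\<lambda>w. indicator (S k) w * (objective y + tolerance + \<delta> / 2))"
          using SM by (intro integrable_mult_left) (simp add: emeasure_eq_measure)
        show "indicator (S k) w * (objective y + tolerance + \<delta> / 2)
            \<le> indicator (S k) w * objective (x k w)" for w
        proof (cases "w \<in> S k")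
          case True
          then have "?B + \<delta> \<le> objective (x k w)" by (simp add: S_def)
          then have "objective y + tolerance + \<delta> / 2 \<le> objective (x k w)" using y(2) by linarith
          then show ?thesis by (intro mult_left_mono) auto
        qed simp
      qed (rule integrable_objective[OF SM])
      finally show "(objective y + tolerance + \<delta> / 2) * prob (S k)
          \<le> (\<integral>w. indicator (S k) w * objective (x k w) \<partial>M)" .
    qed (use \<delta> in auto)
    then have "(\<Inter>k. S k) \<in> null_sets M"
      using SM by (intro null_setsI) (auto simp: emeasure_eq_measure)
    then show ?thesis
      by (rule AE_I') (auto simp: S_def not_less)
  qed
  then have "AE w in M. \<forall>n. \<exists>k. objective (x k w) < ?B + 1 / real (Suc n)"
    by (simp add: AE_all_countable del: of_nat_Suc)
  then show ?thesis
  proof (rule eventually_mono)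
    fix w assume close: "\<forall>n. \<exists>k. objective (x k w) < ?B + 1 / real (Suc n)"
    show "(INF k. ereal (objective (x k w))) \<le> ereal ?B"
    proof (rule ereal_le_epsilon2)
      fix d :: real assume "d > 0"
      then obtain n where n: "1 / real (Suc n) < d" using nat_approx_posE by blast
      obtain k where "objective (x k w) < ?B + 1 / real (Suc n)" using close by blast
      with n have "ereal (objective (x k w)) \<le> ereal ?B + ereal d" by simp
      then show "(INF k. ereal (objective (x k w))) \<le> ereal ?B + ereal d"
        by (rule INF_lower2[OF UNIV_I])
    qed
  qed
qed

end

theorem theorem3p4:
  fixes M :: "'w measure"
    and X :: "(real ^ 'n) set"
    and m :: nat
    and f :: "nat \<Rightarrow> real ^ 'n \<Rightarrow> real"
    and F :: "real ^ 'n \<Rightarrow> real"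
    and C :: "nat \<Rightarrow> real"
    and \<alpha> \<mu> \<nu> fstar :: real
    and \<mu>s \<nu>s :: "nat \<Rightarrow> real"
    and x :: "nat \<Rightarrow> 'w \<Rightarrow> real ^ 'n"
    and z g \<epsilon> :: "nat \<Rightarrow> nat \<Rightarrow> 'w \<Rightarrow> real ^ 'n"
  assumes "prob_space M"
    and "X \<noteq> {}" and "closed X" and "convex X" and "bounded X"
    and "\<And>i. i \<in> {1..m} \<Longrightarrow> convex_on UNIV (f i)"
    and "F = (\<lambda>y. \<Sum>i=1..m. f i y)"
    and "fstar = (INF y\<in>X. F y)"
    and "\<And>i y v. i \<in> {1..m} \<Longrightarrow> y \<in> X \<Longrightarrow> is_subgradient (f i) v y \<Longrightarrow> norm v \<le> C i"
    and "\<alpha> > 0"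
    and "x 0 \<in> borel_measurable M"
    and "\<And>w. w \<in> space M \<Longrightarrow> x 0 w \<in> X"
    and "\<And>i k. i \<in> {1..m} \<Longrightarrow> k \<ge> 1 \<Longrightarrow> \<epsilon> i k \<in> borel_measurable M"
    and "\<And>k w. w \<in> space M \<Longrightarrow> z 0 (k + 1) w = x k w"
    and "\<And>i k w. i \<in> {1..m} \<Longrightarrow> w \<in> space M \<Longrightarrow>
           is_subgradient (f i) (g i (k + 1) w) (z (i - 1) (k + 1) w)"
    and "\<And>i k w. i \<in> {1..m} \<Longrightarrow> w \<in> space M \<Longrightarrow>
           z i (k + 1) w =
             closest_point X (z (i - 1) (k + 1) w - \<alpha> *\<^sub>R (g i (k + 1) w + \<epsilon> i (k + 1) w))"
    and "\<And>k w. w \<in> space M \<Longrightarrow> x (k + 1) w = z m (k + 1) w"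
    and "\<And>i k. i \<in> {1..m} \<Longrightarrow> k \<ge> 1 \<Longrightarrow>
           z i k \<in> borel_measurable (history M m (x 0) \<epsilon> k i)"
    and "\<And>k. k \<ge> 1 \<Longrightarrow> \<mu>s k \<ge> 0" and "\<And>k. k \<ge> 1 \<Longrightarrow> \<nu>s k \<ge> 0"
    and "\<And>i k. i \<in> {1..m} \<Longrightarrow> k \<ge> 1 \<Longrightarrow>
           AE w in M. norm (vec_cond_exp M (history M m (x 0) \<epsilon> k (i - 1)) (\<epsilon> i k) w) \<le> \<mu>s k"
    and "\<And>i k. i \<in> {1..m} \<Longrightarrow> k \<ge> 1 \<Longrightarrow>
           AE w in M. nn_cond_exp M (history M m (x 0) \<epsilon> k (i - 1))
                        (\<lambda>u. ennreal ((norm (\<epsilon> i k u))\<^sup>2)) w \<le> ennreal ((\<nu>s k)\<^sup>2)"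
    and "bdd_above (\<mu>s ` {1..})" and "\<mu> = (SUP k\<in>{1..}. \<mu>s k)"
    and "bdd_above (\<nu>s ` {1..})" and "\<nu> = (SUP k\<in>{1..}. \<nu>s k)"
  shows "liminf (\<lambda>k. ereal (\<integral>w. F (x k w) \<partial>M))
           \<le> ereal (fstar + real m * \<mu> * diameter X
                     + \<alpha> / 2 * ((\<Sum>i=1..m. C i) + real m * \<nu>)\<^sup>2)
       \<and> (AE w in M. (INF k. ereal (F (x k w)))
           \<le> ereal (fstar + real m * \<mu> * diameter X
                     + \<alpha> / 2 * ((\<Sum>i=1..m. C i) + real m * \<nu>)\<^sup>2))"
proof -
  have bias: "\<mu>s k \<le> \<mu>" if "k \<ge> 1" for k
    using that assms(23,24) by (auto intro!: cSUP_upper)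
  have noise: "\<nu>s k \<le> \<nu>" if "k \<ge> 1" for k
    using that assms(25,26) by (auto intro!: cSUP_upper)
  interpret prob_space M by (rule assms(1))
  interpret incremental_stochastic_subgradient M X m f C \<alpha> \<mu> \<nu> x z g \<epsilon>
  proof
    show "0 \<le> \<mu>" using assms(19)[of 1] bias[of 1] by simp
    show "0 \<le> \<nu>" using assms(20)[of 1] noise[of 1] by simp
    show "AE w in M. norm (vec_cond_exp M (history M m (x 0) \<epsilon> k (i - 1)) (\<epsilon> i k) w) \<le> \<mu>"
      if "i \<in> {1..m}" "k \<ge> 1" for i k
      using assms(21)[OF that] bias[OF that(2)] by (auto elim!: eventually_mono)
    show "AE w in M. nn_cond_exp M (history M m (x 0) \<epsilon> k (i - 1))
        (\<lambda>u. ennreal ((norm (\<epsilon> i k u))\<^sup>2)) w \<le> ennreal (\<nu>\<^sup>2)"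
      if "i \<in> {1..m}" "k \<ge> 1" for i k
    proof -
      have "ennreal ((\<nu>s k)\<^sup>2) \<le> ennreal (\<nu>\<^sup>2)"
        using noise[OF that(2)] assms(20)[OF that(2)] by (intro ennreal_leI power_mono)
      with assms(22)[OF that] show ?thesis by (auto elim!: eventually_mono intro: order_trans)
    qed
  qed (fact assms)+
  have F: "F = objective" using assms(7) by (simp add: objective_def fun_eq_iff)
  have "fstar + real m * \<mu> * diameter X + \<alpha> / 2 * ((\<Sum>i=1..m. C i) + real m * \<nu>)\<^sup>2
      = (INF y\<in>X. objective y) + tolerance"
    by (simp add: tolerance_def assms(8) F)
  then show ?thesis
    using liminf_expected_objective inf_objective_almost_surely by (simp only: F)
qed

end
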